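(* Let $G$ be a directed acyclic graph, $s$ a vertex of $G$, and $T_s$ a depth-first search arborescence of $G$ rooted at $s$. Let $s_1$ be a child of $s$ in $T_s$, let $u$ and $v$ belong to $T_{s_1}$, let $z = LCA_{T_s}(u,v)$, and suppose $z\neq u$ and $z \neq v$. Then $s \in J(u,v)$ if and only if $s \in J(z,u)$ or $s\in J(z,v)$.
   Context: All paths are directed, and a single vertex counts as a (trivial) directed path. For distinct vertices $u,v$ of $G$, a vertex $s$ is a junction of $u,v$ if there are internally disjoint directed paths $P$ from $s$ to $u$ and $Q$ from $s$ to $v$ in $G$, where internally disjoint means that $s$ is the only vertex common to $P$ and $Q$. $J(u,v)=J(v,u)$ is the set of junctions of $u,v$ in $G$, and $J(u,u)=\emptyset$ by convention. In particular, a proper ancestor $u$ of $v$ lies in $J(u,v)$. The arborescence $T_s$ is the rooted directed tree built by a depth-first search of $G$ started at $s$; its vertices are $s$ and all descendants of $s$ in $G$, and its arcs are the tree arcs of the search. For $u\in T_s$, $T_u$ is the subarborescence of $T_s$ rooted at $u$ (consisting of $u$ and all its descendants in $T_s$). $LCA_{T_s}(u,v)$ is the unique lowest common ancestor of $u$ and $v$ in the rooted tree $T_s$ (it equals $u$ if $u$ is an ancestor of $v$ in $T_s$). *)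

theory Defs
  imports "Graph_Theory.Digraph_Component"
begin

locale dag = fin_digraph +
  assumes acyclic: "\<not> cycle c"

text \<open>
  Walks are lists of arcs, so the vertices of the path \<open>p\<close> from \<open>s\<close> are
  \<open>awalk_verts s p\<close>, and the trivial path is \<open>[]\<close>.
\<close>

definition junctions :: "('a, 'b) pre_digraph \<Rightarrow> 'a \<Rightarrow> 'a \<Rightarrow> 'a set" where
  "junctions G u v =
    (if u = v then {}
     else {s. \<exists>p q. pre_digraph.apath G s p u \<and> pre_digraph.apath G s q v \<and>
       set (pre_digraph.awalk_verts G s p) \<inter> set (pre_digraph.awalk_verts G s q) = {s}})"

text \<open>
  \<open>dfs_visit G x (V, A) (V', A')\<close>: the search is at the already visited vertex \<open>x\<close>,
  with visited vertices \<open>V\<close> and tree arcs \<open>A\<close>; from here on it processes \<open>x\<close> until it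
  backtracks from \<open>x\<close>, at which point \<open>V'\<close> and \<open>A'\<close> are the visited vertices and tree
  arcs. The next arc to an unvisited vertex is chosen freely, so every order of the
  adjacency lists is covered.
\<close>

inductive dfs_visit ::
  "('a, 'b) pre_digraph \<Rightarrow> 'a \<Rightarrow> 'a set \<times> 'b set \<Rightarrow> 'a set \<times> 'b set \<Rightarrow> bool"
  for G :: "('a, 'b) pre_digraph" where
  backtrack: "(\<forall>e\<in>out_arcs G x. head G e \<in> V) \<Longrightarrow> dfs_visit G x (V, A) (V, A)"
| descend: "\<lbrakk>e \<in> out_arcs G x; head G e \<notin> V;
    dfs_visit G (head G e) (insert (head G e) V, insert e A) (V1, A1);
    dfs_visit G x (V1, A1) (V2, A2)\<rbrakk> \<Longrightarrow> dfs_visit G x (V, A) (V2, A2)"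

definition dfs_arborescence ::
  "('a, 'b) pre_digraph \<Rightarrow> 'a \<Rightarrow> ('a, 'b) pre_digraph \<Rightarrow> bool" where
  "dfs_arborescence G s T \<longleftrightarrow>
    (\<exists>V A. dfs_visit G s ({s}, {}) (V, A) \<and>
       T = \<lparr>verts = V, arcs = A, tail = tail G, head = head G\<rparr>)"

definition subarborescence :: "('a, 'b) pre_digraph \<Rightarrow> 'a \<Rightarrow> ('a, 'b) pre_digraph" where
  "subarborescence T r = T \<restriction> {v. r \<rightarrow>\<^sup>*\<^bsub>T\<^esub> v}"

definition common_ancestors :: "('a, 'b) pre_digraph \<Rightarrow> 'a \<Rightarrow> 'a \<Rightarrow> 'a set" where
  "common_ancestors T u v = {z. z \<rightarrow>\<^sup>*\<^bsub>T\<^esub> u \<and> z \<rightarrow>\<^sup>*\<^bsub>T\<^esub> v}"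

text \<open>
  Lowest means that no proper descendant is again a common ancestor. Such a vertex is
  unique because \<open>T\<close> is an arborescence; for other digraphs \<open>lca\<close> may be unspecified.
\<close>

definition lca :: "('a, 'b) pre_digraph \<Rightarrow> 'a \<Rightarrow> 'a \<Rightarrow> 'a" where
  "lca T u v =
    (THE z. z \<in> common_ancestors T u v \<and> \<not> (\<exists>w\<in>common_ancestors T u v. z \<rightarrow>\<^sup>+\<^bsub>T\<^esub> w))"

end

theory Submission
  imports Defs
begin

text \<open>
  Both directions are path surgery in which only two properties of the search tree matter: it is
  a subgraph of the acyclic graph, and each of its vertices has at most one incoming tree arc.
  If \<open>P\<close> and \<open>Q\<close> witness \<open>s \<in> J(u,v)\<close>, let \<open>y\<close> be the last vertex of the tree path from \<open>s\<close> to \<open>z\<close>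
  that lies on \<open>P\<close> or \<open>Q\<close>; following that walk up to \<open>y\<close> and then the tree path gives a path to \<open>z\<close>
  that avoids the other walk.  Conversely, if \<open>P\<close> and \<open>Q\<close> witness \<open>s \<in> J(z,u)\<close>, let \<open>w\<close> be the first
  vertex of \<open>Q\<close> on one of the tree paths from \<open>z\<close> to \<open>u\<close> and to \<open>v\<close>; leaving \<open>Q\<close> at \<open>w\<close> along that
  tree path is disjoint from \<open>P\<close> continued along the other one.
\<close>

section \<open>Cutting walks at a vertex or at a set of vertices\<close>

context wf_digraph begin

lemma last_in_awalk_verts: "awalk u p v \<Longrightarrow> v \<in> set (awalk_verts u p)"
  by (metis awlast_of_awalk awalkE' awalk_verts_non_Nil last_in_set)

lemma awalk_split_first:
  assumes "awalk u p v" and "set (awalk_verts u p) \<inter> S \<noteq> {}"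
  obtains q r w where "awalk u q w" "awalk w r v"
    "set (awalk_verts u p) = set (awalk_verts u q) \<union> set (awalk_verts w r)"
    "set (awalk_verts u q) \<inter> S = {w}"
proof -
  have "\<exists>x\<in>set (awalk_verts u p). x \<in> S" using assms(2) by blast
  then obtain xs w ys where l: "awalk_verts u p = xs @ w # ys" "w \<in> S" "\<forall>x\<in>set xs. x \<notin> S"
    by (rule split_list_first_propE)
  have c: "cas u p v" using assms(1) by blast
  obtain q r where qr: "cas u q w" "cas w r v" "p = q @ r" "awalk_verts u q = xs @ [w]"
    "awalk_verts w r = w # ys"
    using awalk_decomp_verts[OF c l(1)] by blast
  have "w \<in> verts G" using l(1) assms(1) by fastforce
  then have "awalk u q w" "awalk w r v"
    using qr assms(1) by (auto simp: awalk_def)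
  then show thesis using that[of q w r] qr(4,5) l by auto
qed

lemma awalk_split_last:
  assumes "awalk u p v" and "set (awalk_verts u p) \<inter> S \<noteq> {}"
  obtains r w where "awalk w r v" "set (awalk_verts w r) \<subseteq> set (awalk_verts u p)"
    "set (awalk_verts w r) \<inter> S = {w}"
proof -
  have "\<exists>x\<in>set (awalk_verts u p). x \<in> S" using assms(2) by blast
  then obtain xs w ys where l: "awalk_verts u p = xs @ w # ys" "w \<in> S" "\<forall>x\<in>set ys. x \<notin> S"
    by (rule split_list_last_propE)
  have c: "cas u p v" using assms(1) by blast
  obtain q r where qr: "cas u q w" "cas w r v" "p = q @ r" "awalk_verts u q = xs @ [w]"
    "awalk_verts w r = w # ys"
    using awalk_decomp_verts[OF c l(1)] by blast
  have "w \<in> verts G" using l(1) assms(1) by fastforce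
  then have "awalk w r v"
    using qr assms(1) by (auto simp: awalk_def)
  then show thesis using that[of w r] qr(4,5) l by auto
qed

lemma awalk_decomp_set:
  assumes "awalk u p v" and "w \<in> set (awalk_verts u p)"
  obtains q r where "awalk u q w" "awalk w r v"
    "set (awalk_verts u p) = set (awalk_verts u q) \<union> set (awalk_verts w r)"
  using awalk_decomp[OF assms] set_awalk_verts_append that by metis

end

section \<open>Junctions and path surgery in an acyclic digraph\<close>

lemma junctions_commute: "junctions G u v = junctions G v u"
  unfolding junctions_def by (auto simp: Int_commute)

context dag begin

text \<open>A repeated vertex would enclose a nonempty closed walk, which contains a cycle.\<close>

lemma awalk_imp_apath:
  assumes "awalk u p v" shows "apath u p v"
proof (rule ccontr)
  assume "\<not> apath u p v"
  then have "\<not> distinct (awalk_verts u p)" using assms by (simp add: apath_def)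
  then obtain r w where "awalk w r w" "0 < length r"
    using awalk_not_distinct_decomp[OF assms] by blast
  then show False using closed_w_imp_cycle[of r] acyclic by (auto simp: closed_w_def)
qed

lemma not_reachable1_self: "\<not> x \<rightarrow>\<^sup>+ x"
proof
  assume "x \<rightarrow>\<^sup>+ x"
  then obtain p where "awalk x p x" "p \<noteq> []" by (auto simp: reachable1_awalk)
  then show False using closed_w_imp_cycle[of p] acyclic by (auto simp: closed_w_def)
qed

lemma reachable_antisym: "x \<rightarrow>\<^sup>* y \<Longrightarrow> y \<rightarrow>\<^sup>* x \<Longrightarrow> x = y"
  using not_reachable1_self[of x] reachable1_reachable_trans[of x y x] by blast

text \<open>Walks are paths by acyclicity, so concatenations need no distinctness check. As
  \<open>s\<close> starts both walks, an inclusion in \<open>{s}\<close> is already an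
  equality.\<close>

lemma junctions_iff_awalk:
  "s \<in> junctions G u v \<longleftrightarrow> u \<noteq> v \<and> (\<exists>p q. awalk s p u \<and> awalk s q v \<and>
     set (awalk_verts s p) \<inter> set (awalk_verts s q) \<subseteq> {s})"
proof -
  have "apath s p x \<longleftrightarrow> awalk s p x" for p x
    using awalk_imp_apath awalkI_apath by blast
  moreover have "A \<inter> B = {s} \<longleftrightarrow> A \<inter> B \<subseteq> {s}" if "s \<in> A" "s \<in> B" for A B
    using that by blast
  ultimately show ?thesis
    unfolding junctions_def using hd_in_awalk_verts(1) by (smt (verit, best) emptyE mem_Collect_eq)
qed

lemma junctionsI:
  assumes "u \<noteq> v" "awalk s p u" "awalk s q v"
    "set (awalk_verts s p) \<inter> set (awalk_verts s q) \<subseteq> {s}"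
  shows "s \<in> junctions G u v"
  using assms unfolding junctions_iff_awalk by blast

text \<open>The new walk follows \<open>p\<close> to \<open>y\<close> and then \<open>r\<close>. It
  can meet \<open>q\<close> only in vertices of \<open>p\<close>, since \<open>y\<close> lies on
  \<open>p\<close>, hence only in \<open>s\<close>.\<close>

lemma junctions_detour:
  assumes P: "awalk s p u" and Q: "awalk s q v"
    and PQ: "set (awalk_verts s p) \<inter> set (awalk_verts s q) \<subseteq> {s}"
    and R: "awalk y r z" "set (awalk_verts y r) \<inter> set (awalk_verts s q) \<subseteq> {y}"
    and y: "y \<in> set (awalk_verts s p)"
    and "z \<noteq> v"
  shows "s \<in> junctions G z v"
proof -
  obtain p1 p2 where p1: "awalk s p1 y"
    "set (awalk_verts s p) = set (awalk_verts s p1) \<union> set (awalk_verts y p2)"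
    using awalk_decomp_set[OF P y] by metis
  have "awalk s (p1 @ r) z" using p1 R by (blast intro: awalk_appendI)
  moreover have "set (awalk_verts s (p1 @ r)) = set (awalk_verts s p1) \<union> set (awalk_verts y r)"
    by (rule set_awalk_verts_append[OF p1(1) R(1)])
  ultimately show ?thesis
    using junctionsI[OF \<open>z \<noteq> v\<close> _ Q] p1 PQ R(2) y by blast
qed

text \<open>The forward implication, with \<open>r\<close> in the role of the tree walk from
  \<open>s\<close> to \<open>z\<close>. The walk containing \<open>y\<close> is diverted to
  \<open>z\<close> and the other one is kept, which decides the disjunct.\<close>

lemma junctions_imp_junctions_branch:
  assumes "s \<in> junctions G u v" and R: "awalk s r z" and "z \<noteq> u" "z \<noteq> v"
  shows "s \<in> junctions G z u \<or> s \<in> junctions G z v"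
proof -
  obtain p q where P: "awalk s p u" and Q: "awalk s q v"
    and PQ: "set (awalk_verts s p) \<inter> set (awalk_verts s q) \<subseteq> {s}"
    using assms(1) unfolding junctions_iff_awalk by blast
  let ?S = "set (awalk_verts s p) \<union> set (awalk_verts s q)"
  have "set (awalk_verts s r) \<inter> ?S \<noteq> {}"
    using hd_in_awalk_verts(1)[OF R] hd_in_awalk_verts(1)[OF P] by blast
  then obtain r' y where r': "awalk y r' z" "set (awalk_verts y r') \<inter> ?S = {y}"
    using awalk_split_last[OF R] by metis
  then consider "y \<in> set (awalk_verts s p)" | "y \<in> set (awalk_verts s q)" by blast
  then show ?thesis
  proof cases
    case 1
    then show ?thesis using junctions_detour[OF P Q PQ r'(1)] r'(2) assms(4) by blast
  next
    case 2
    then show ?thesis using junctions_detour[OF Q P _ r'(1)] PQ r'(2) assms(3) by blast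
  qed
qed

text \<open>The disjoint walks are \<open>p @ a\<close> and \<open>q @ b2\<close>, where
  \<open>b2\<close> is the part of \<open>b\<close> from \<open>w\<close> on. Vertices of
  \<open>p\<close> reach \<open>z\<close>, while those of \<open>b2\<close> lie strictly below
  \<open>z\<close>, so \<open>p\<close> and \<open>b2\<close> cannot meet.\<close>

lemma junctions_reroute:
  assumes P: "awalk s p z" and Q: "awalk s q w"
    and A: "awalk z a x" and B: "awalk z b y"
    and PQ: "set (awalk_verts s p) \<inter> set (awalk_verts s q) \<subseteq> {s}"
    and AB: "set (awalk_verts z a) \<inter> set (awalk_verts z b) \<subseteq> {z}"
    and QAB: "set (awalk_verts s q) \<inter> (set (awalk_verts z a) \<union> set (awalk_verts z b)) = {w}"
    and w: "w \<in> set (awalk_verts z b)"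
    and "s \<noteq> z" "x \<noteq> y"
  shows "s \<in> junctions G x y"
proof -
  \<comment> \<open>Otherwise \<open>z\<close> would lie on both \<open>p\<close> and
    \<open>q\<close>, forcing \<open>z = s\<close>.\<close>
  have wz: "w \<noteq> z"
    using PQ QAB \<open>s \<noteq> z\<close> last_in_awalk_verts[OF P] by blast
  obtain b1 b2 where b: "awalk z b1 w" "awalk w b2 y"
    "set (awalk_verts z b) = set (awalk_verts z b1) \<union> set (awalk_verts w b2)"
    using awalk_decomp_set[OF B w] by metis
  have zw: "z \<rightarrow>\<^sup>* w" using b(1) by (rule reachable_awalkI)
  \<comment> \<open>Such a \<open>t\<close> would close a circuit from \<open>z\<close> through
    \<open>w\<close> and \<open>t\<close> back to \<open>z\<close>.\<close>
  have z: "False" if "t \<in> set (awalk_verts w b2)" "t \<rightarrow>\<^sup>* z" for t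
  proof -
    have "w \<rightarrow>\<^sup>* t" using awalk_verts_reachable_from[OF b(2)] that(1) by blast
    then show False using that(2) zw wz reachable_trans reachable_antisym by blast
  qed
  have pb: "set (awalk_verts s p) \<inter> set (awalk_verts w b2) = {}"
    using z awalk_verts_reachable_to[OF P] by blast
  have "z \<notin> set (awalk_verts w b2)"
    using z P by blast
  then have ab: "set (awalk_verts z a) \<inter> set (awalk_verts w b2) = {}"
    using AB Un_upper2[of "set (awalk_verts w b2)" "set (awalk_verts z b1)"] unfolding b(3) by blast
  have "w \<notin> set (awalk_verts z a)" using AB w wz by blast
  then have aq: "set (awalk_verts z a) \<inter> set (awalk_verts s q) = {}"
    using equalityD1[OF QAB] by blast
  have pa: "awalk s (p @ a) x"
    "set (awalk_verts s (p @ a)) = set (awalk_verts s p) \<union> set (awalk_verts z a)"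
    using awalk_appendI[OF P A] set_awalk_verts_append[OF P A] .
  have qb: "awalk s (q @ b2) y"
    "set (awalk_verts s (q @ b2)) = set (awalk_verts s q) \<union> set (awalk_verts w b2)"
    using awalk_appendI[OF Q b(2)] set_awalk_verts_append[OF Q b(2)] .
  have "set (awalk_verts s (p @ a)) \<inter> set (awalk_verts s (q @ b2)) \<subseteq> {s}"
    unfolding pa(2) qb(2) Int_Un_distrib Int_Un_distrib2 using PQ pb ab aq by simp
  then show ?thesis using junctionsI pa(1) qb(1) \<open>x \<noteq> y\<close> by blast
qed

text \<open>The converse implication. The exit vertex \<open>w\<close> exists because
  \<open>q\<close> ends in \<open>u\<close>, which lies on \<open>a\<close>. If \<open>w\<close> is
  on \<open>a\<close>, the roles of \<open>a\<close> and \<open>b\<close> are exchanged.\<close>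

lemma junctions_branch_imp_junctions:
  assumes "s \<in> junctions G z u" and A: "awalk z a u" and B: "awalk z b v"
    and AB: "set (awalk_verts z a) \<inter> set (awalk_verts z b) \<subseteq> {z}"
    and "s \<noteq> z" "u \<noteq> v"
  shows "s \<in> junctions G u v"
proof -
  obtain p q where P: "awalk s p z" and Q: "awalk s q u"
    and PQ: "set (awalk_verts s p) \<inter> set (awalk_verts s q) \<subseteq> {s}"
    using assms(1) unfolding junctions_iff_awalk by blast
  let ?S = "set (awalk_verts z a) \<union> set (awalk_verts z b)"
  have "u \<in> set (awalk_verts s q)" "u \<in> set (awalk_verts z a)"
    using last_in_awalk_verts Q A by blast+
  then have "set (awalk_verts s q) \<inter> ?S \<noteq> {}" by blast
  then obtain q1 q2 w where q1: "awalk s q1 w" "set (awalk_verts s q1) \<inter> ?S = {w}"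
    "set (awalk_verts s q) = set (awalk_verts s q1) \<union> set (awalk_verts w q2)"
    using awalk_split_first[OF Q] by metis
  have PQ1: "set (awalk_verts s p) \<inter> set (awalk_verts s q1) \<subseteq> {s}" using PQ q1(3) by blast
  from q1(2) consider "w \<in> set (awalk_verts z b)" | "w \<in> set (awalk_verts z a)" by blast
  then show ?thesis
  proof cases
    case 1
    then show ?thesis using junctions_reroute[OF P q1(1) A B PQ1 AB] q1(2) assms(5,6) by blast
  next
    case 2
    have "s \<in> junctions G v u"
      using junctions_reroute[OF P q1(1) B A PQ1] 2 AB q1(2) assms(5,6)
      by (metis Int_commute Un_commute)
    then show ?thesis by (simp add: junctions_commute)
  qed
qed

end

section \<open>Lowest common ancestors when each vertex has at most one incoming arc\<close>

locale branching = dag +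
  assumes inj_on_head: "inj_on (head G) (arcs G)"
begin

text \<open>Induction along a walk from \<open>a\<close> to \<open>u\<close>: unless
  \<open>b = u\<close>, a walk from \<open>b\<close> must enter \<open>u\<close> by the same unique
  arc, so both ancestors reach the same predecessor.\<close>

lemma ancestors_comparable:
  assumes "a \<rightarrow>\<^sup>* u" "b \<rightarrow>\<^sup>* u"
  shows "a \<rightarrow>\<^sup>* b \<or> b \<rightarrow>\<^sup>* a"
  using assms
proof (induction rule: reachable_induct)
  case base
  then show ?case by blast
next
  case (step y u)
  show ?case
  proof (cases "b = u")
    case True
    then show ?thesis using step reachable_adj_trans by blast
  next
    case False
    then have "b \<rightarrow>\<^sup>+ u" using step.prems by blast
    then obtain y' where y': "b \<rightarrow>\<^sup>* y'" "y' \<rightarrow> u"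
      by (metis reachable1_in_verts(1) reachable1_reachable reachable_refl tranclE)
    have "y' = y"
      using y'(2) step.hyps inj_on_head by (auto simp: inj_on_def arcs_ends_conv)
    then show ?thesis using step.IH y' by blast
  qed
qed

text \<open>Justifies the definite description in \<open>lca\<close>. Finiteness and acyclicity give
  a lowest common ancestor; by comparability every common ancestor reaches it, which makes it
  unique.\<close>

lemma lca_properties:
  assumes "a \<in> common_ancestors G u v"
  shows "lca G u v \<in> common_ancestors G u v"
    and "\<And>w. w \<in> common_ancestors G u v \<Longrightarrow> w \<rightarrow>\<^sup>* lca G u v"
proof -
  let ?C = "common_ancestors G u v"
  let ?P = "\<lambda>z. z \<in> ?C \<and> \<not> (\<exists>w\<in>?C. z \<rightarrow>\<^sup>+ w)"
  have "finite (arcs_ends G)" by (simp add: arcs_ends_def)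
  moreover have "acyclic (arcs_ends G)"
    using not_reachable1_self by (simp add: acyclic_def)
  \<comment> \<open>The converse order is used so that a minimal element is one without proper
    descendants in the set.\<close>
  ultimately have "wf (((arcs_ends G)\<^sup>+)\<inverse>)"
    by (simp add: finite_acyclic_wf_converse trancl_converse[symmetric] wf_trancl)
  from this assms obtain z where "z \<in> ?C" "\<And>y. (y, z) \<in> ((arcs_ends G)\<^sup>+)\<inverse> \<Longrightarrow> y \<notin> ?C"
    by (rule wfE_min) blast
  then have z: "?P z" by auto
  have max: "w \<rightarrow>\<^sup>* x" if "?P x" "w \<in> ?C" for x w
  proof -
    have "w \<rightarrow>\<^sup>* x \<or> x \<rightarrow>\<^sup>* w"
      using that ancestors_comparable by (auto simp: common_ancestors_def)
    then show ?thesis using that by (metis reachable_neq_reachable1)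
  qed
  have "lca G u v = z"
    unfolding lca_def using z max reachable_antisym by (intro the_equality) blast+
  then show "lca G u v \<in> ?C" "\<And>w. w \<in> ?C \<Longrightarrow> w \<rightarrow>\<^sup>* lca G u v"
    using z max by blast+
qed

text \<open>A shared vertex is a common ancestor, so it reaches the \<open>lca\<close> from which it
  is itself reached.\<close>

lemma awalks_from_lca_disjoint:
  assumes "awalk (lca G u v) p u" "awalk (lca G u v) q v"
  shows "set (awalk_verts (lca G u v) p) \<inter> set (awalk_verts (lca G u v) q) \<subseteq> {lca G u v}"
proof
  fix x assume x: "x \<in> set (awalk_verts (lca G u v) p) \<inter> set (awalk_verts (lca G u v) q)"
  then have "x \<in> common_ancestors G u v" "lca G u v \<rightarrow>\<^sup>* x"
    using awalk_verts_reachable_to[OF assms(1)] awalk_verts_reachable_to[OF assms(2)]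
      awalk_verts_reachable_from[OF assms(1)]
    by (auto simp: common_ancestors_def)
  then show "x \<in> {lca G u v}" using lca_properties(2) reachable_antisym by blast
qed

end

section \<open>Invariants of depth-first search\<close>

context wf_digraph begin

text \<open>Heads stay distinct because a new tree arc enters an unvisited vertex, whereas the heads
  of all earlier tree arcs have been visited.\<close>

lemma dfs_visit_invariant:
  assumes "dfs_visit G x (V, A) (V', A')"
    and "x \<in> V" "V \<subseteq> verts G" "A \<subseteq> arcs G" "tail G ` A \<subseteq> V" "head G ` A \<subseteq> V" "inj_on (head G) A"
  shows "V \<subseteq> V' \<and> V' \<subseteq> verts G \<and> A' \<subseteq> arcs G \<and> tail G ` A' \<subseteq> V' \<and> head G ` A' \<subseteq> V' \<and>
    inj_on (head G) A'"
  using assms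
proof (induction x "(V, A)" "(V', A')" arbitrary: V A V' A' rule: dfs_visit.induct)
  case (backtrack x V A)
  then show ?case by blast
next
  case (descend e x V A V1 A1 V2 A2)
  have e: "e \<in> arcs G" "tail G e = x" using descend.hyps by (auto simp: out_arcs_def)
  then have "inj_on (head G) (insert e A)"
    using descend.prems(5,6) descend.hyps(2) by (simp add: inj_on_insert) blast
  then have "insert (head G e) V \<subseteq> V1 \<and> V1 \<subseteq> verts G \<and> A1 \<subseteq> arcs G \<and> tail G ` A1 \<subseteq> V1 \<and>
      head G ` A1 \<subseteq> V1 \<and> inj_on (head G) A1"
    using e descend.prems by (intro descend.hyps(4)) auto
  moreover from this have "V1 \<subseteq> V2 \<and> V2 \<subseteq> verts G \<and> A2 \<subseteq> arcs G \<and> tail G ` A2 \<subseteq> V2 \<and>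
      head G ` A2 \<subseteq> V2 \<and> inj_on (head G) A2"
    using descend.prems by (intro descend.hyps(6)) auto
  ultimately show ?case by (meson insert_subset subset_trans)
qed

end

lemma (in dag) dfs_arborescence_branching:
  assumes "dfs_arborescence G s T" "s \<in> verts G"
  shows "subgraph T G" "branching T"
proof -
  obtain V A where VA: "dfs_visit G s ({s}, {}) (V, A)"
    and T: "T = \<lparr>verts = V, arcs = A, tail = tail G, head = head G\<rparr>"
    using assms(1) unfolding dfs_arborescence_def by blast
  have inv: "V \<subseteq> verts G \<and> A \<subseteq> arcs G \<and> tail G ` A \<subseteq> V \<and> head G ` A \<subseteq> V \<and> inj_on (head G) A"
    using dfs_visit_invariant[OF VA] assms(2) by auto
  have "wf_digraph T" using inv by unfold_locales (auto simp: T)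
  then show sub: "subgraph T G"
    using inv wf_digraph_axioms by (auto simp: subgraph_def compatible_def T)
  have "fin_digraph T" using sub by (rule fin_digraph_subgraph)
  then show "branching T"
    using inv subgraph_cycle[OF sub] acyclic
    by (auto simp: branching_def branching_axioms_def dag_def dag_axioms_def T)
qed

theorem lemma2:
  fixes G T :: "('a, 'b) pre_digraph" and s s1 u v z :: 'a
  assumes "dag G"
    and "s \<in> verts G"
    and "dfs_arborescence G s T"
    and "s \<rightarrow>\<^bsub>T\<^esub> s1"
    and "u \<in> verts (subarborescence T s1)"
    and "v \<in> verts (subarborescence T s1)"
    and "z = lca T u v"
    and "z \<noteq> u"
    and "z \<noteq> v"
  shows "s \<in> junctions G u v \<longleftrightarrow> s \<in> junctions G z u \<or> s \<in> junctions G z v"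
proof -
  interpret dag G by fact
  have sub: "subgraph T G" and "branching T"
    using dfs_arborescence_branching[OF assms(3,2)] .
  interpret T: branching T by fact
  \<comment> \<open>The vertex list of a walk depends only on \<open>tail\<close> and
    \<open>head\<close>, which \<open>T\<close> shares with \<open>G\<close>.\<close>
  have verts_eq: "T.awalk_verts = awalk_verts"
    using sub by (intro compatible_awalk_verts) (auto simp: subgraph_def compatible_def)
  \<comment> \<open>This common ancestor makes \<open>lca\<close> well defined and places
    \<open>z\<close> at or below \<open>s1\<close>, hence strictly below \<open>s\<close>.\<close>
  have s1: "s1 \<in> common_ancestors T u v"
    using assms(5,6) by (simp add: subarborescence_def common_ancestors_def)
  have z: "z \<in> common_ancestors T u v" "s1 \<rightarrow>\<^sup>*\<^bsub>T\<^esub> z"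
    using T.lca_properties[OF s1] s1 assms(7) by auto
  have sz: "s \<rightarrow>\<^sup>+\<^bsub>T\<^esub> z"
    using assms(4) z(2) T.reachable1_reachable_trans by blast
  then have "s \<noteq> z" using T.not_reachable1_self by blast
  \<comment> \<open>If they coincided, \<open>u\<close> would be a common ancestor of the pair and
    so equal to \<open>z\<close>.\<close>
  have "u \<noteq> v"
  proof
    assume "u = v"
    then have "u \<in> common_ancestors T u v"
      using z(1) T.reachable_in_verts by (auto simp: common_ancestors_def)
    then have "u \<rightarrow>\<^sup>*\<^bsub>T\<^esub> z" using T.lca_properties(2) assms(7) by blast
    then show False
      using z(1) T.reachable_antisym assms(8) by (auto simp: common_ancestors_def)
  qed
  obtain r a b where T_walks: "T.awalk s r z" "T.awalk z a u" "T.awalk z b v"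
    using T.reachable1_reachable[OF sz] z(1) by (auto simp: common_ancestors_def T.reachable_awalk)
  have walks: "awalk s r z" "awalk z a u" "awalk z b v"
    using T_walks subgraph_awalk_imp_awalk sub by blast+
  have ab: "set (awalk_verts z a) \<inter> set (awalk_verts z b) \<subseteq> {z}"
    using T.awalks_from_lca_disjoint T_walks assms(7) by (metis verts_eq)
  show ?thesis
  proof
    assume "s \<in> junctions G u v"
    then show "s \<in> junctions G z u \<or> s \<in> junctions G z v"
      using junctions_imp_junctions_branch walks(1) assms(8,9) by blast
  next
    assume "s \<in> junctions G z u \<or> s \<in> junctions G z v"
    then show "s \<in> junctions G u v"
    proof
      assume "s \<in> junctions G z u"
      then show ?thesis
        using junctions_branch_imp_junctions walks(2,3) ab \<open>s \<noteq> z\<close> \<open>u \<noteq> v\<close> by blast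
    next
      assume "s \<in> junctions G z v"
      then have "s \<in> junctions G v u"
        using junctions_branch_imp_junctions[OF _ walks(3,2)] ab \<open>s \<noteq> z\<close> \<open>u \<noteq> v\<close> by blast
      then show ?thesis by (simp add: junctions_commute)
    qed
  qed
qed

end
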